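(* Let $X\subset\mathbb{R}^N$ ($N\geqslant 1$) be an open $p$-convex set and let $\phi:\mathbb{R}\times X\to X$ be a flow which is eventually cooperative or eventually competitive with respect to the order induced by a convex cone $C\subset\mathbb{R}^N$. Let $x\in X$ and let $x(t)=\phi_t(x)$ be its trajectory, having the complete orbit (i.e. defined for all $t\in\mathbb{R}$). Then $x(t)$ cannot have both an increasing interval and a decreasing interval.
   Context: A nonempty closed set $C\subset\mathbb{R}^N$ is called a convex cone if $C+C\subset C$, $\alpha C\subset C$ for all $\alpha\geqslant 0$, and $C\cap(-C)=\{0\}$. Write $x\leqslant y$ if $y-x\in C$, and $x<y$ (equivalently $y>x$) if $y-x\in C\setminus\{0\}$. A subset $U\subset\mathbb{R}^N$ is $p$-convex if whenever $x,y\in U$ and $x\leqslant y$, the line segment between $x$ and $y$ is contained in $U$. A flow $\phi_t$ (continuous, defined for all $t\in\mathbb{R}$) on $X$ is eventually cooperative (resp. eventually competitive) if there exists $t_*\geqslant 0$ such that $\phi_t(x)\leqslant\phi_t(y)$ whenever $x,y\in X$, $x\leqslant y$ and $t\geqslant t_*$ (resp. $t\leqslant -t_*$). For a trajectory $x(t)$, a time interval $[a,b]\subset\mathbb{R}$ with $a<b$ is called an increasing interval if $x(a)<x(b)$, and a decreasing interval if $x(a)>x(b)$. *)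

theory Defs
  imports "HOL-Analysis.Analysis"
begin

(* Stronger than the library's convex_cone: the cone is also closed and pointed. *)
definition order_cone :: "'a::real_normed_vector set \<Rightarrow> bool" where
  "order_cone C \<longleftrightarrow>
     C \<noteq> {} \<and> closed C \<and>
     (\<forall>x\<in>C. \<forall>y\<in>C. x + y \<in> C) \<and>
     (\<forall>\<alpha>\<ge>0. \<forall>x\<in>C. \<alpha> *\<^sub>R x \<in> C) \<and>
     C \<inter> uminus ` C = {0}"

definition cone_le :: "'a::real_vector set \<Rightarrow> 'a \<Rightarrow> 'a \<Rightarrow> bool" where
  "cone_le C x y \<longleftrightarrow> y - x \<in> C"

definition cone_less :: "'a::real_vector set \<Rightarrow> 'a \<Rightarrow> 'a \<Rightarrow> bool" where
  "cone_less C x y \<longleftrightarrow> y - x \<in> C - {0}"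

definition p_convex :: "'a::real_vector set \<Rightarrow> 'a set \<Rightarrow> bool" where
  "p_convex C U \<longleftrightarrow> (\<forall>x\<in>U. \<forall>y\<in>U. cone_le C x y \<longrightarrow> closed_segment x y \<subseteq> U)"

(* \<phi> is a total function; its values at points outside X are irrelevant. *)
definition flow_on :: "'a::topological_space set \<Rightarrow> (real \<Rightarrow> 'a \<Rightarrow> 'a) \<Rightarrow> bool" where
  "flow_on X \<phi> \<longleftrightarrow>
     (\<forall>t. \<forall>x\<in>X. \<phi> t x \<in> X) \<and>
     (\<forall>x\<in>X. \<phi> 0 x = x) \<and>
     (\<forall>s t. \<forall>x\<in>X. \<phi> (s + t) x = \<phi> s (\<phi> t x)) \<and>
     continuous_on (UNIV \<times> X) (\<lambda>(t, x). \<phi> t x)"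

definition eventually_cooperative ::
  "'a::real_vector set \<Rightarrow> 'a set \<Rightarrow> (real \<Rightarrow> 'a \<Rightarrow> 'a) \<Rightarrow> bool" where
  "eventually_cooperative C X \<phi> \<longleftrightarrow>
     (\<exists>T\<ge>0. \<forall>x\<in>X. \<forall>y\<in>X. \<forall>t\<ge>T. cone_le C x y \<longrightarrow> cone_le C (\<phi> t x) (\<phi> t y))"

definition eventually_competitive ::
  "'a::real_vector set \<Rightarrow> 'a set \<Rightarrow> (real \<Rightarrow> 'a \<Rightarrow> 'a) \<Rightarrow> bool" where
  "eventually_competitive C X \<phi> \<longleftrightarrow>
     (\<exists>T\<ge>0. \<forall>x\<in>X. \<forall>y\<in>X. \<forall>t\<le>-T. cone_le C x y \<longrightarrow> cone_le C (\<phi> t x) (\<phi> t y))"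

definition increasing_interval ::
  "'a::real_vector set \<Rightarrow> (real \<Rightarrow> 'a) \<Rightarrow> real \<Rightarrow> real \<Rightarrow> bool" where
  "increasing_interval C u a b \<longleftrightarrow> a < b \<and> cone_less C (u a) (u b)"

definition decreasing_interval ::
  "'a::real_vector set \<Rightarrow> (real \<Rightarrow> 'a) \<Rightarrow> real \<Rightarrow> real \<Rightarrow> bool" where
  "decreasing_interval C u a b \<longleftrightarrow> a < b \<and> cone_less C (u b) (u a)"

end

theory Submission
  imports Defs
begin

text \<open>
  By time reversal the flow may be taken eventually cooperative. Since the flow is order preserving
  and injective, an increasing interval of length \<open>r\<close> and a decreasing one of length \<open>s\<close> may be
  translated to the right, so that from some time \<open>a\<close> on \<open>x(t) < x(t + r)\<close> and \<open>x(t + s) < x(t)\<close>.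
  If \<open>r < s\<close>, then \<open>x(t + s) < x(t + r)\<close>, so \<open>s - r\<close> is a decreasing length from time \<open>a + r\<close> on;
  symmetrically for \<open>s < r\<close>, whereas \<open>r = s\<close> is absurd. This subtractive Euclidean algorithm never
  increases \<open>a + r + s\<close>, hence there are, say, arbitrarily small increasing lengths that are all valid
  from one common time on. As \<open>C\<close> is closed, the trajectory is then eventually nondecreasing, which
  contradicts the existence of a decreasing length.
\<close>

section \<open>The strict order induced by a pointed cone\<close>

lemma order_cone_closed: "order_cone C \<Longrightarrow> closed C"
  by (simp add: order_cone_def)

lemma order_cone_add: "order_cone C \<Longrightarrow> x \<in> C \<Longrightarrow> y \<in> C \<Longrightarrow> x + y \<in> C"
  by (simp add: order_cone_def)

lemma order_cone_zero: "order_cone C \<Longrightarrow> 0 \<in> C"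
  by (metis Int_iff insertI1 order_cone_def)

lemma order_cone_pointed:
  assumes "order_cone C" "x \<in> C" "- x \<in> C"
  shows "x = 0"
proof -
  have "x \<in> C \<inter> uminus ` C"
    using assms(2,3) by (metis IntI image_eqI minus_minus)
  also have "C \<inter> uminus ` C = {0}"
    using assms(1) by (simp add: order_cone_def)
  finally show ?thesis
    by simp
qed

lemma cone_less_not_ge: "order_cone C \<Longrightarrow> cone_less C x y \<Longrightarrow> x - y \<notin> C"
  using order_cone_pointed[of C "y - x"] by (auto simp: cone_less_def)

lemma cone_less_irrefl: "\<not> cone_less C x x"
  by (simp add: cone_less_def)

lemma cone_less_trans:
  assumes "order_cone C" "cone_less C x y" "cone_less C y z"
  shows "cone_less C x z"
proof -
  have C: "y - x \<in> C" "z - y \<in> C"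
    using assms by (auto simp: cone_less_def)
  have "z - x \<in> C"
    using order_cone_add[OF assms(1) C] by simp
  moreover have "z \<noteq> x"
    using cone_less_not_ge[OF assms(1,2)] C(2) by auto
  ultimately show ?thesis
    by (simp add: cone_less_def)
qed

section \<open>Trajectories and time reversal\<close>

lemma flow_onD:
  assumes "flow_on X \<phi>" "x \<in> X"
  shows "\<phi> t x \<in> X" "\<phi> 0 x = x" "\<phi> (s + t) x = \<phi> s (\<phi> t x)"
  using assms unfolding flow_on_def by blast+

lemma continuous_on_trajectory:
  assumes "flow_on X \<phi>" "x \<in> X"
  shows "continuous_on UNIV (\<lambda>t. \<phi> t x)"
proof -
  have "continuous_on (UNIV \<times> X) (\<lambda>(t, x). \<phi> t x)"
    using assms unfolding flow_on_def by blast
  then have "continuous_on UNIV (\<lambda>t. (\<lambda>(t, x). \<phi> t x) (t, x))"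
    by (rule continuous_on_compose2) (use assms in \<open>auto intro!: continuous_intros\<close>)
  then show ?thesis
    by simp
qed

text \<open>Reduces the competitive case to the cooperative one.\<close>

lemma flow_on_reverse:
  assumes "flow_on X \<phi>"
  shows "flow_on X (\<lambda>t. \<phi> (- t))"
proof -
  have "continuous_on (UNIV \<times> X) (\<lambda>(t, x). \<phi> t x)"
    using assms unfolding flow_on_def by blast
  then have "continuous_on (UNIV \<times> X) (\<lambda>p. (\<lambda>(t, x). \<phi> t x) (- fst p, snd p))"
    by (rule continuous_on_compose2) (auto intro!: continuous_intros)
  then have cont: "continuous_on (UNIV \<times> X) (\<lambda>(t, x). \<phi> (- t) x)"
    by (simp add: case_prod_unfold)
  show ?thesis
    unfolding flow_on_def
  proof (intro conjI allI ballI)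
    show "\<phi> (- (s + t)) x = \<phi> (- s) (\<phi> (- t) x)" if "x \<in> X" for s t x
      using flow_onD(3)[OF assms that, of "- s" "- t"] by simp
  qed (use flow_onD(1,2)[OF assms] cont in simp_all)
qed

section \<open>Monotonicity from arbitrarily small lengths\<close>

text \<open>Multiples of small valid lengths are again valid and approximate every
  \<open>v \<ge> 0\<close>; continuity of \<open>u\<close> and closedness of \<open>C\<close> carry
  the relation to the limit.\<close>

lemma nondecreasing_of_small_increasing_lengths:
  fixes u :: "real \<Rightarrow> 'a::real_normed_vector"
  assumes "order_cone C" and cont: "continuous_on UNIV u"
    and small: "\<And>\<epsilon>. \<epsilon> > 0 \<Longrightarrow> \<exists>r. 0 < r \<and> r < \<epsilon> \<and> (\<forall>t\<ge>T. u (t + r) - u t \<in> C)"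
    and "t \<ge> T" "v \<ge> 0"
  shows "u (t + v) - u t \<in> C"
proof -
  have multiples: "u (t + real n * r) - u t \<in> C"
    if r: "0 < r" "\<forall>t\<ge>T. u (t + r) - u t \<in> C" for n r
  proof (induction n)
    case 0
    show ?case using order_cone_zero[OF assms(1)] by simp
  next
    case (Suc n)
    have "t + real n * r \<ge> T"
      using r(1) assms(4) by (simp add: add_increasing2)
    then have "u (t + real n * r + r) - u (t + real n * r) \<in> C"
      using r(2) by blast
    from order_cone_add[OF assms(1) this Suc.IH] show ?case
      by (simp add: algebra_simps)
  qed
  have "u (t + v) - u t \<in> closure C"
    unfolding closure_approachable
  proof (intro allI impI)
    fix e :: real assume "e > 0"
    with cont obtain d where d: "d > 0" "\<And>w. dist w (t + v) < d \<Longrightarrow> dist (u w) (u (t + v)) < e"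
      unfolding continuous_on_iff by blast
    obtain r where r: "0 < r" "r < d" "\<forall>t\<ge>T. u (t + r) - u t \<in> C"
      using small[OF d(1)] by blast
    \<comment> \<open>With this \<open>n\<close>, the time \<open>t + n * r\<close> is at most
      \<open>t + v\<close> and misses it by less than \<open>r < d\<close>.\<close>
    define n where "n = nat \<lfloor>v / r\<rfloor>"
    have "real n = of_int \<lfloor>v / r\<rfloor>"
      using \<open>v \<ge> 0\<close> r(1) by (simp add: n_def)
    then have "real n \<le> v / r" "v / r < real n + 1"
      by linarith+
    then have "real n * r \<le> v" "v < real n * r + r"
      using r(1) by (simp_all add: field_simps)
    then have "dist (t + real n * r) (t + v) < d"
      using r(2) by (simp add: dist_real_def)
    then have "dist (u (t + real n * r) - u t) (u (t + v) - u t) < e"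
      using d(2) by (simp add: dist_norm)
    then show "\<exists>y\<in>C. dist y (u (t + v) - u t) < e"
      using multiples[OF r(1,3)] by blast
  qed
  then show ?thesis
    using order_cone_closed[OF assms(1)] by simp
qed

section \<open>The subtractive Euclidean algorithm on lengths\<close>

text \<open>The state of the algorithm. Validity at every \<open>t \<ge> a\<close>, not just at one
  time, is what allows the two relations to be chained.\<close>

definition opposite_lengths ::
  "'a::real_vector set \<Rightarrow> (real \<Rightarrow> 'a) \<Rightarrow> real \<Rightarrow> real \<Rightarrow> real \<Rightarrow> bool" where
  "opposite_lengths C u a r s \<longleftrightarrow> r > 0 \<and> s > 0 \<and>
     (\<forall>t\<ge>a. cone_less C (u t) (u (t + r)) \<and> cone_less C (u (t + s)) (u t))"

lemma opposite_lengthsD: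
  assumes "opposite_lengths C u a r s"
  shows "r > 0" "s > 0" "t \<ge> a \<Longrightarrow> cone_less C (u t) (u (t + r))"
    "t \<ge> a \<Longrightarrow> cone_less C (u (t + s)) (u t)"
  using assms unfolding opposite_lengths_def by blast+

lemma opposite_lengths_neq:
  assumes "order_cone C" "opposite_lengths C u a r s"
  shows "r \<noteq> s"
proof
  assume "r = s"
  with cone_less_trans[OF assms(1) opposite_lengthsD(4)[OF assms(2) order_refl]
      opposite_lengthsD(3)[OF assms(2) order_refl]]
  show False
    by (simp add: cone_less_irrefl)
qed

text \<open>Starting from \<open>t - r\<close>, one has
  \<open>u (t - r + s) < u (t - r) < u t\<close>. The start moves right by \<open>r\<close> while
  the sum of the lengths drops by \<open>r\<close>, so \<open>a + r + s\<close> is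
  invariant.\<close>

lemma opposite_lengths_diff_right:
  assumes "order_cone C" "opposite_lengths C u a r s" "r < s"
  shows "opposite_lengths C u (a + r) r (s - r)"
  unfolding opposite_lengths_def
proof (intro conjI allI impI)
  fix t assume t: "t \<ge> a + r"
  show "cone_less C (u t) (u (t + r))"
    using t opposite_lengthsD(1)[OF assms(2)] by (intro opposite_lengthsD(3)[OF assms(2)]) simp
  have t': "t - r \<ge> a"
    using t by linarith
  from cone_less_trans[OF assms(1) opposite_lengthsD(4)[OF assms(2) t']
      opposite_lengthsD(3)[OF assms(2) t']]
  show "cone_less C (u (t + (s - r))) (u t)"
    by (simp add: algebra_simps)
qed (use opposite_lengthsD(1,2)[OF assms(2)] assms(3) in simp_all)

lemma opposite_lengths_diff_left:
  assumes "order_cone C" "opposite_lengths C u a r s" "s < r"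
  shows "opposite_lengths C u (a + s) (r - s) s"
  unfolding opposite_lengths_def
proof (intro conjI allI impI)
  fix t assume t: "t \<ge> a + s"
  show "cone_less C (u (t + s)) (u t)"
    using t opposite_lengthsD(2)[OF assms(2)] by (intro opposite_lengthsD(4)[OF assms(2)]) simp
  have t': "t - s \<ge> a"
    using t by linarith
  from cone_less_trans[OF assms(1) opposite_lengthsD(4)[OF assms(2) t']
      opposite_lengthsD(3)[OF assms(2) t']]
  show "cone_less C (u t) (u (t + (r - s)))"
    by (simp add: algebra_simps)
qed (use opposite_lengthsD(1,2)[OF assms(2)] assms(3) in simp_all)

text \<open>While both lengths are at least \<open>\<epsilon>\<close>, each subtraction lowers
  \<open>r + s\<close> by at least \<open>\<epsilon>\<close>, so a multiple of
  \<open>\<epsilon>\<close> above \<open>r + s\<close> bounds the number of steps. Invariance of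
  \<open>a + r + s\<close> bounds the final start time.\<close>

lemma opposite_lengths_small:
  assumes "order_cone C" "opposite_lengths C u a r s" "\<epsilon> > 0"
  shows "\<exists>a' r' s'. opposite_lengths C u a' r' s' \<and> a' \<le> a + r + s \<and> min r' s' < \<epsilon>"
proof -
  obtain n where "r + s < real n * \<epsilon>"
    using reals_Archimedean3[OF assms(3)] by blast
  with assms(2) show ?thesis
  proof (induction n arbitrary: a r s)
    case 0
    then show ?case by (auto simp: opposite_lengths_def)
  next
    case (Suc n)
    have pos: "r > 0" "s > 0"
      using opposite_lengthsD(1,2)[OF Suc.prems(1)] .
    consider "min r s < \<epsilon>" | "\<epsilon> \<le> r" "r < s" | "\<epsilon> \<le> s" "s < r"
      using opposite_lengths_neq[OF assms(1) Suc.prems(1)] by linarith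
    then show ?case
    proof cases
      case 1
      with Suc.prems(1) pos show ?thesis
        by (intro exI[of _ a] exI[of _ r] exI[of _ s]) auto
    next
      case 2
      have "r + (s - r) < real n * \<epsilon>"
        using Suc.prems(2) 2 by (simp add: algebra_simps)
      from Suc.IH[OF opposite_lengths_diff_right[OF assms(1) Suc.prems(1) 2(2)] this]
      show ?thesis by (simp add: ac_simps)
    next
      case 3
      have "r - s + s < real n * \<epsilon>"
        using Suc.prems(2) 3 by (simp add: algebra_simps)
      from Suc.IH[OF opposite_lengths_diff_left[OF assms(1) Suc.prems(1) 3(2)] this]
      show ?thesis by simp
    qed
  qed
qed

lemma no_opposite_lengths:
  fixes u :: "real \<Rightarrow> 'a::real_normed_vector"
  assumes "order_cone C" and cont: "continuous_on UNIV u"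
  shows "\<not> opposite_lengths C u a r s"
proof
  assume ol: "opposite_lengths C u a r s"
  \<comment> \<open>This bound on the start times does not depend on \<open>\<epsilon>\<close>, so
    all the small lengths are valid from \<open>T\<close> on.\<close>
  define T where "T = a + r + s"
  define inc where "inc q \<longleftrightarrow> 0 < q \<and> (\<forall>t\<ge>T. u (t + q) - u t \<in> C)" for q
  \<comment> \<open>Phrased for \<open>- u\<close>, so that the monotonicity lemma applies to it
    with the same cone.\<close>
  define dec where "dec q \<longleftrightarrow> 0 < q \<and> (\<forall>t\<ge>T. - u (t + q) - - u t \<in> C)" for q
  have rs: "r > 0" "s > 0" and less: "cone_less C (u T) (u (T + r))" "cone_less C (u (T + s)) (u T)"
    using opposite_lengthsD(1,2)[OF ol] opposite_lengthsD(3,4)[OF ol, of T] by (auto simp: T_def)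
  have small: "\<exists>q<\<epsilon>. inc q \<or> dec q" if "\<epsilon> > 0" for \<epsilon>
  proof -
    obtain a' r' s' where "opposite_lengths C u a' r' s'" "a' \<le> T" "min r' s' < \<epsilon>"
      using opposite_lengths_small[OF assms(1) ol \<open>\<epsilon> > 0\<close>] unfolding T_def by blast
    then have "inc r'" "dec s'" "r' < \<epsilon> \<or> s' < \<epsilon>"
      by (auto simp: inc_def dec_def opposite_lengths_def cone_less_def)
    then show ?thesis by blast
  qed
  \<comment> \<open>Which of the two lengths is small may vary with \<open>\<epsilon>\<close>, but
    one kind must occur below every \<open>\<epsilon>\<close>.\<close>
  have "(\<forall>\<epsilon>>0. \<exists>q<\<epsilon>. inc q) \<or> (\<forall>\<epsilon>>0. \<exists>q<\<epsilon>. dec q)"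
  proof (rule ccontr)
    assume "\<not> ?thesis"
    then obtain d e where "d > 0" "\<forall>q<d. \<not> inc q" "e > 0" "\<forall>q<e. \<not> dec q"
      by blast
    with small[of "min d e"] show False by auto
  qed
  then consider "\<forall>\<epsilon>>0. \<exists>q<\<epsilon>. inc q" | "\<forall>\<epsilon>>0. \<exists>q<\<epsilon>. dec q"
    by blast
  then show False
  proof cases
    case 1
    have "u (T + s) - u T \<in> C"
      by (rule nondecreasing_of_small_increasing_lengths[OF assms])
        (use 1 rs in \<open>auto simp: inc_def\<close>)
    with cone_less_not_ge[OF assms(1) less(2)] show False
      by simp
  next
    case 2
    have "- u (T + r) - - u T \<in> C"
      by (rule nondecreasing_of_small_increasing_lengths[OF assms(1)])
        (use 2 rs cont in \<open>auto simp: dec_def intro: continuous_intros\<close>)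
    with cone_less_not_ge[OF assms(1) less(1)] show False
      by simp
  qed
qed

section \<open>Application to flows\<close>

text \<open>Monotonicity yields only the weak relation; strictness survives because flowing back by
  \<open>- h\<close> would turn equal images into equal points.\<close>

lemma trajectory_cone_less_shift:
  assumes "flow_on X \<phi>" "x \<in> X"
    and mono: "\<And>y z t. y \<in> X \<Longrightarrow> z \<in> X \<Longrightarrow> t \<ge> T \<Longrightarrow> cone_le C y z \<Longrightarrow>
                 cone_le C (\<phi> t y) (\<phi> t z)"
    and less: "cone_less C (\<phi> a x) (\<phi> b x)" and "h \<ge> T"
  shows "cone_less C (\<phi> (h + a) x) (\<phi> (h + b) x)"
proof -
  note X = flow_onD(1)[OF assms(1,2)] and add = flow_onD(3)[OF assms(1,2)]
  have "cone_le C (\<phi> (h + a) x) (\<phi> (h + b) x)"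
    using mono[OF X X \<open>h \<ge> T\<close>, of a b] less by (simp add: add cone_le_def cone_less_def)
  moreover have "\<phi> (h + a) x \<noteq> \<phi> (h + b) x"
  proof
    assume "\<phi> (h + a) x = \<phi> (h + b) x"
    then have "\<phi> (- h + (h + a)) x = \<phi> (- h + (h + b)) x"
      by (simp only: add[of "- h"])
    with less show False
      by (simp add: cone_less_def)
  qed
  ultimately show ?thesis
    by (simp add: cone_le_def cone_less_def)
qed

lemma eventually_cooperative_no_opposite_intervals:
  fixes \<phi> :: "real \<Rightarrow> 'a::real_normed_vector \<Rightarrow> 'a"
  assumes "order_cone C" "flow_on X \<phi>" "eventually_cooperative C X \<phi>" "x \<in> X"
    and inc: "increasing_interval C (\<lambda>t. \<phi> t x) a b"
    and dec: "decreasing_interval C (\<lambda>t. \<phi> t x) c d"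
  shows False
proof -
  obtain T where "\<forall>y\<in>X. \<forall>z\<in>X. \<forall>t\<ge>T. cone_le C y z \<longrightarrow> cone_le C (\<phi> t y) (\<phi> t z)"
    using assms(3) by (auto simp: eventually_cooperative_def)
  then have shift: "cone_less C (\<phi> (h + p) x) (\<phi> (h + q) x)"
    if "cone_less C (\<phi> p x) (\<phi> q x)" "h \<ge> T" for p q h
    by (intro trajectory_cone_less_shift[OF assms(2,4) _ that]) blast
  \<comment> \<open>For \<open>t\<close> beyond this start, both shifts \<open>t - a\<close> and
    \<open>t - c\<close> are at least \<open>T\<close>.\<close>
  have "opposite_lengths C (\<lambda>t. \<phi> t x) (T + max a c) (b - a) (d - c)"
    unfolding opposite_lengths_def
  proof (intro conjI allI impI)
    fix t assume t: "t \<ge> T + max a c"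
    show "cone_less C (\<phi> t x) (\<phi> (t + (b - a)) x)"
      using shift[of a b "t - a"] inc t by (simp add: increasing_interval_def algebra_simps)
    show "cone_less C (\<phi> (t + (d - c)) x) (\<phi> t x)"
      using shift[of d c "t - c"] dec t by (simp add: decreasing_interval_def algebra_simps)
  qed (use inc dec in \<open>auto simp: increasing_interval_def decreasing_interval_def\<close>)
  with no_opposite_lengths[OF assms(1) continuous_on_trajectory[OF assms(2,4)]] show False
    by blast
qed

theorem theorem2p1:
  fixes C X :: "(real ^ 'n) set"
    and \<phi> :: "real \<Rightarrow> real ^ 'n \<Rightarrow> real ^ 'n"
    and x :: "real ^ 'n"
  assumes "order_cone C"
    and "open X"
    and "p_convex C X"
    and "flow_on X \<phi>"
    and "eventually_cooperative C X \<phi> \<or> eventually_competitive C X \<phi>"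
    and "x \<in> X"
  shows "\<not> ((\<exists>a b. increasing_interval C (\<lambda>t. \<phi> t x) a b) \<and>
            (\<exists>c d. decreasing_interval C (\<lambda>t. \<phi> t x) c d))"
proof
  assume "(\<exists>a b. increasing_interval C (\<lambda>t. \<phi> t x) a b) \<and>
          (\<exists>c d. decreasing_interval C (\<lambda>t. \<phi> t x) c d)"
  then obtain a b c d where inc: "increasing_interval C (\<lambda>t. \<phi> t x) a b"
    and dec: "decreasing_interval C (\<lambda>t. \<phi> t x) c d"
    by blast
  from assms(5) show False
  proof
    assume "eventually_cooperative C X \<phi>"
    from eventually_cooperative_no_opposite_intervals[OF assms(1,4) this assms(6) inc dec]
    show False .
  next
    assume "eventually_competitive C X \<phi>"
    then obtain T where T: "T \<ge> 0"
      "\<forall>y\<in>X. \<forall>z\<in>X. \<forall>t\<le>-T. cone_le C y z \<longrightarrow> cone_le C (\<phi> t y) (\<phi> t z)"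
      unfolding eventually_competitive_def by blast
    have coop: "eventually_cooperative C X (\<lambda>t. \<phi> (- t))"
      unfolding eventually_cooperative_def using T by (intro exI[of _ T]) simp
    \<comment> \<open>Reversing time swaps the endpoints and hence the two kinds of
      interval.\<close>
    have "increasing_interval C (\<lambda>t. \<phi> (- t) x) (- d) (- c)"
      using dec by (simp add: increasing_interval_def decreasing_interval_def)
    moreover have "decreasing_interval C (\<lambda>t. \<phi> (- t) x) (- b) (- a)"
      using inc by (simp add: increasing_interval_def decreasing_interval_def)
    ultimately show False
      by (rule eventually_cooperative_no_opposite_intervals[OF assms(1)
            flow_on_reverse[OF assms(4)] coop assms(6)])
  qed
qed

end
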